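(* For every integer $n\ge 1$, $\widehat{p}(K_n)=2^{\lceil \lg n\rceil}-1$.
   Context: All graphs are finite and simple; $K_n$ is the complete graph on $n$ vertices; $\lg$ is the logarithm to base 2. An edge-coloring of a graph $G$ is any assignment of colors to the edges of $G$. A walk is closed if its two endpoints coincide, and open otherwise. A parity walk (in an edge-coloring) is a walk along which every color is used an even number of times, counting edges with multiplicity of traversal. A strong parity edge-coloring (spec) of $G$ is an edge-coloring in which every parity walk is closed. $\widehat{p}(G)$ is the minimum number of colors in a strong parity edge-coloring of $G$. *)

theory Defs
  imports Complex_Main "Graph_Theory.Graph_Theory"
begin

text \<open>
  As usual in \<open>Graph_Theory\<close>, a finite simple graph is a symmetric digraph (locale \<open>graph\<close>), so
  an edge is a pair of opposite arcs.  Edge-colorings are therefore functions on the set of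
  endpoints of an arc, which gives both arcs of an edge the same color.  The values of such a
  function outside \<open>edges G\<close> are irrelevant.
\<close>

definition edge_of :: "('a, 'b) pre_digraph \<Rightarrow> 'b \<Rightarrow> 'a set" where
  "edge_of G e = {tail G e, head G e}"

definition edges :: "('a, 'b) pre_digraph \<Rightarrow> 'a set set" where
  "edges G = edge_of G ` arcs G"

definition parity_walk ::
  "('a, 'b) pre_digraph \<Rightarrow> ('a set \<Rightarrow> 'c) \<Rightarrow> 'a \<Rightarrow> 'b awalk \<Rightarrow> 'a \<Rightarrow> bool" where
  "parity_walk G c u p v \<longleftrightarrow>
     pre_digraph.awalk G u p v \<and> (\<forall>x. even (count_list (map (c \<circ> edge_of G) p) x))"

definition strong_parity_edge_coloring ::
  "('a, 'b) pre_digraph \<Rightarrow> ('a set \<Rightarrow> 'c) \<Rightarrow> bool" where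
  "strong_parity_edge_coloring G c \<longleftrightarrow> (\<forall>u p v. parity_walk G c u p v \<longrightarrow> u = v)"

text \<open>Natural numbers suffice as colors, since only finite graphs are considered.\<close>

definition p_hat :: "('a, 'b) pre_digraph \<Rightarrow> nat" where
  "p_hat G = (LEAST k. \<exists>c :: 'a set \<Rightarrow> nat.
     strong_parity_edge_coloring G c \<and> card (c ` edges G) = k)"

end

theory Submission
  imports Defs "HOL-Library.Z2" "HOL-Library.Function_Algebras"
begin

text \<open>
  Lower bound: let \<open>W\<close> be the set of parity vectors over \<open>\<int>/2\<close> of the closed walks at a fixed
  vertex \<open>r\<close>.  Modulo \<open>W\<close> every vertex \<open>v\<close> has a potential, the parity vector of any walk from \<open>r\<close>
  to \<open>v\<close>, and the color vector of an edge is the sum of the potentials of its endpoints.  In a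
  strong parity edge-coloring the potentials are distinct, so the claim becomes
  \<open>\<bar>A + A\<bar> \<ge> 2 ^ k\<close> for every set \<open>A\<close> of more than \<open>2 ^ (k - 1)\<close> elements of an elementary abelian
  2-group.  This follows from: \<open>\<bar>A\<bar> + \<bar>B\<bar> > 2 ^ k\<close> implies \<open>\<bar>A + B\<bar> \<ge> 2 ^ k\<close> for nonempty \<open>A\<close>, \<open>B\<close>.
  If both sets have at least two elements, some subgroup of index two splits \<open>A\<close> into
  nonempty \<open>A\<^sub>0\<close>, \<open>A\<^sub>1\<close> and \<open>B\<close> into nonempty \<open>B\<^sub>0\<close>, \<open>B\<^sub>1\<close>.  One of the pairs \<open>(A\<^sub>0, B\<^sub>0)\<close>, \<open>(A\<^sub>1, B\<^sub>1)\<close>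
  has total size above \<open>2 ^ (k - 1)\<close>, and so has one of \<open>(A\<^sub>0, B\<^sub>1)\<close>, \<open>(A\<^sub>1, B\<^sub>0)\<close>; by induction each
  coset of the subgroup contains at least \<open>2 ^ (k - 1)\<close> elements of \<open>A + B\<close>.

  Upper bound: label the vertices injectively with numbers below \<open>2 ^ k\<close> and color each edge with
  the XOR of its two labels.
\<close>

section \<open>Sumsets in elementary abelian 2-groups\<close>

text \<open>The set is the union of the cosets \<open>M\<close> and \<open>M + t\<close>; two
  elements of \<open>M + t\<close> have their sum in \<open>M\<close> because
  \<open>t + t = 0\<close>.\<close>

lemma adjoin_subgroup_closed:
  fixes M :: "'g::ab_group_add set"
  assumes double: "\<And>x::'g. x + x = 0"
    and add: "\<And>x y. x \<in> M \<Longrightarrow> y \<in> M \<Longrightarrow> x + y \<in> M"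
    and "x \<in> M \<union> {z. z + t \<in> M}" "y \<in> M \<union> {z. z + t \<in> M}"
  shows "x + y \<in> M \<union> {z. z + t \<in> M}"
proof -
  have "x + t + (y + t) = x + y + (t + t)" by (simp add: algebra_simps)
  then have *: "x + t + (y + t) = x + y" by (simp add: double)
  show ?thesis
    using assms(3,4) add[of x y] add[of "x + t" "y + t"] add[of x "y + t"] add[of "x + t" y]
    unfolding * by (auto simp: algebra_simps)
qed

text \<open>\<open>M\<close> acts as the kernel of a linear functional over Z/2 that vanishes on
  \<open>W\<close> and is 1 at \<open>d\<close> and \<open>e\<close>. It is maximal among the
  subgroups that contain \<open>W\<close> and \<open>d + e\<close> but not \<open>d\<close>.\<close>

lemma index_two_subgroup:
  fixes W :: "'g::ab_group_add set"
  assumes double: "\<And>x::'g. x + x = 0"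
    and zero: "0 \<in> W" and add: "\<And>x y. x \<in> W \<Longrightarrow> y \<in> W \<Longrightarrow> x + y \<in> W"
    and d: "d \<notin> W" and e: "e \<notin> W"
  obtains M where "W \<subseteq> M" "d \<notin> M" "e \<notin> M" "\<And>x y. x + y \<in> M \<longleftrightarrow> (x \<in> M \<longleftrightarrow> y \<in> M)"
proof -
  have cancel: "x + (x + y) = y" for x y :: 'g
    using double[of x] by (simp flip: add.assoc)
  define F where
    "F = {M. W \<subseteq> M \<and> d + e \<in> M \<and> d \<notin> M \<and> (\<forall>x\<in>M. \<forall>y\<in>M. x + y \<in> M)}"
  \<comment> \<open>Adjoining \<open>d + e\<close> forces \<open>d\<close> and \<open>e\<close> to stay out together.\<close>
  have "W \<union> {z. z + (d + e) \<in> W} \<in> F"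
    unfolding F_def using zero d e adjoin_subgroup_closed[OF double add, of _ "d + e"]
    by (simp add: double cancel del: Un_iff) (auto simp: double cancel)
  then have "F \<noteq> {}" by blast
  moreover have "\<Union>C \<in> F" if C: "C \<noteq> {}" "subset.chain F C" for C
  proof -
    have CF: "C \<subseteq> F" using C(2) by (auto simp: subset_chain_def)
    have "x + y \<in> \<Union>C" if "x \<in> \<Union>C" "y \<in> \<Union>C" for x y
    proof -
      from that obtain X Y where XY: "X \<in> C" "Y \<in> C" "x \<in> X" "y \<in> Y" by blast
      then have "X \<subseteq> Y \<or> Y \<subseteq> X" using C(2) by (auto simp: subset_chain_def)
      then show ?thesis using XY CF unfolding F_def by blast
    qed
    then show ?thesis using C(1) CF unfolding F_def by blast
  qed
  ultimately obtain M where M: "M \<in> F" "\<And>X. X \<in> F \<Longrightarrow> M \<subseteq> X \<Longrightarrow> X = M"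
    using subset_Zorn_nonempty[of F] by blast
  have WM: "W \<subseteq> M" and de: "d + e \<in> M" and dM: "d \<notin> M"
    and Madd: "\<And>x y. x \<in> M \<Longrightarrow> y \<in> M \<Longrightarrow> x + y \<in> M"
    using M(1) by (auto simp: F_def)
  have eM: "e \<notin> M" using Madd[OF de, of e] dM by (auto simp: add.assoc double)
  \<comment> \<open>By maximality, adjoining \<open>x\<close> to \<open>M\<close> captures
    \<open>d\<close>; hence everything outside \<open>M\<close> lies in the single coset
    \<open>M + d\<close>.\<close>
  have coset: "x + d \<in> M" if "x \<notin> M" for x
  proof -
    let ?N = "M \<union> {z. z + x \<in> M}"
    have "x \<in> ?N" using WM zero by (auto simp: double)
    then have "?N \<notin> F" using M(2)[of ?N] that by blast
    moreover have "u + v \<in> ?N" if "u \<in> ?N" "v \<in> ?N" for u v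
      using adjoin_subgroup_closed[OF double Madd that] .
    ultimately have "d \<in> ?N" using WM de unfolding F_def by blast
    then show ?thesis using dM by (simp add: add.commute)
  qed
  have "x + y \<in> M \<longleftrightarrow> (x \<in> M \<longleftrightarrow> y \<in> M)" for x y
  proof (cases "x \<in> M \<or> y \<in> M")
    case True
    then show ?thesis
      using Madd[of x y] Madd[of x "x + y"] Madd[of y "y + x"] cancel[of x y] cancel[of y x]
        add.commute[of x y] by metis
  next
    case False
    then have "(x + d) + (y + d) \<in> M" using coset Madd by blast
    moreover have "(x + d) + (y + d) = x + y"
      using double[of d] by (simp add: algebra_simps)
    ultimately show ?thesis using False by simp
  qed
  with that[of M] WM dM eM show ?thesis by blast
qed

text \<open>Quotients are avoided by counting up to congruence modulo \<open>W\<close>; \<open>S\<close> represents \<open>A + B\<close>.\<close>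

lemma sumset_mod_singleton:
  fixes W :: "'g::ab_group_add set"
  assumes double: "\<And>x::'g. x + x = 0"
    and add: "\<And>x y. x \<in> W \<Longrightarrow> y \<in> W \<Longrightarrow> x + y \<in> W"
    and "finite S" and B: "\<And>b b'. b \<in> B \<Longrightarrow> b' \<in> B \<Longrightarrow> b + b' \<in> W \<Longrightarrow> b = b'"
    and S: "\<And>b. b \<in> B \<Longrightarrow> \<exists>s\<in>S. a + b + s \<in> W"
  shows "card B \<le> card S"
proof -
  from S obtain f where f: "\<And>b. b \<in> B \<Longrightarrow> f b \<in> S \<and> a + b + f b \<in> W" by metis
  have "inj_on f B"
  proof (rule inj_onI)
    fix b b' assume *: "b \<in> B" "b' \<in> B" "f b = f b'"
    have "(a + b + f b) + (a + b' + f b') \<in> W" using f * add by blast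
    moreover have "(a + b + f b) + (a + b' + f b') = (a + f b) + (a + f b) + (b + b')"
      using * by (simp add: algebra_simps)
    ultimately have "b + b' \<in> W" by (simp only: double add_0)
    then show "b = b'" using B * by blast
  qed
  then show ?thesis using f \<open>finite S\<close> by (intro card_inj_on_le[of f]) auto
qed

lemma card_sumset_mod_ge:
  fixes W :: "'g::ab_group_add set"
  assumes double: "\<And>x::'g. x + x = 0"
    and zero: "0 \<in> W" and add: "\<And>x y. x \<in> W \<Longrightarrow> y \<in> W \<Longrightarrow> x + y \<in> W"
    and "finite A" "A \<noteq> {}" "\<And>a a'. a \<in> A \<Longrightarrow> a' \<in> A \<Longrightarrow> a + a' \<in> W \<Longrightarrow> a = a'"
    and "finite B" "B \<noteq> {}" "\<And>b b'. b \<in> B \<Longrightarrow> b' \<in> B \<Longrightarrow> b + b' \<in> W \<Longrightarrow> b = b'"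
    and "finite S" "\<And>a b. a \<in> A \<Longrightarrow> b \<in> B \<Longrightarrow> \<exists>s\<in>S. a + b + s \<in> W"
    and "2 ^ k < card A + card B"
  shows "2 ^ k \<le> card S"
  using assms(4-)
proof (induction k arbitrary: A B S)
  case 0
  then have "S \<noteq> {}" by blast
  then show ?case using \<open>finite S\<close> by (simp add: Suc_le_eq card_gt_0_iff)
next
  case (Suc k)
  note finA = Suc.prems(1) and neA = Suc.prems(2) and A = Suc.prems(3)
    and finB = Suc.prems(4) and neB = Suc.prems(5) and B = Suc.prems(6)
    and finS = Suc.prems(7) and S = Suc.prems(8) and big = Suc.prems(9)
  consider (singleton_left) a where "A = {a}" | (singleton_right) b where "B = {b}"
    | (both) a a' b b' where "a \<in> A" "a' \<in> A" "a \<noteq> a'" "b \<in> B" "b' \<in> B" "b \<noteq> b'"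
    using neA neB by blast
  then show ?case
  proof cases
    case singleton_left
    have "card B \<le> card S"
    proof (rule sumset_mod_singleton[OF double add finS B, where a = a])
      show "\<exists>s\<in>S. a + y + s \<in> W" if "y \<in> B" for y
        using S[OF _ that, of a] singleton_left by simp
    qed
    \<comment> \<open>As \<open>A\<close> has one element, the strict bound \<open>big\<close> gives
      \<open>2 ^ Suc k \<le> card B\<close>.\<close>
    then show ?thesis using big singleton_left by simp
  next
    case singleton_right
    have "card A \<le> card S"
    proof (rule sumset_mod_singleton[OF double add finS A, where a = b])
      show "\<exists>s\<in>S. b + x + s \<in> W" if "x \<in> A" for x
        using S[OF that, of b] singleton_right by (simp add: add.commute)
    qed
    then show ?thesis using big singleton_right by simp
  next
    case both
    then have "a + a' \<notin> W" "b + b' \<notin> W" using A B by blast+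
    then obtain M where WM: "W \<subseteq> M" and dM: "a + a' \<notin> M" and eM: "b + b' \<notin> M"
      and M: "\<And>x y. x + y \<in> M \<longleftrightarrow> (x \<in> M \<longleftrightarrow> y \<in> M)"
      by (rule index_two_subgroup[of W, rotated 3]) (use double zero add in auto)
    define cell where "cell X P = {x \<in> X. x \<in> M \<longleftrightarrow> P}" for X P
    have split: "card X = card (cell X True) + card (cell X False)" if "finite X" for X
    proof -
      have "cell X True = X \<inter> M" "cell X False = X - M" by (auto simp: cell_def)
      then show ?thesis using that by (simp add: card_Int_Diff)
    qed
    have step: "2 ^ k \<le> card (cell S (P = Q))"
      if PQ: "2 ^ k < card (cell A P) + card (cell B Q)" for P Q
    proof (rule Suc.IH[of "cell A P" "cell B Q"])
      show "finite (cell A P)" "finite (cell B Q)" "finite (cell S (P = Q))"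
        using finA finB finS by (simp_all add: cell_def)
      \<comment> \<open>\<open>M\<close> separates \<open>a\<close> from \<open>a'\<close> and
        \<open>b\<close> from \<open>b'\<close>, so no cell of \<open>A\<close> or \<open>B\<close>
        is empty.\<close>
      show "cell A P \<noteq> {}" "cell B Q \<noteq> {}"
        using both dM eM M unfolding cell_def by blast+
      show "x = x'" if "x \<in> cell A P" "x' \<in> cell A P" "x + x' \<in> W" for x x'
        using that A by (simp add: cell_def)
      show "y = y'" if "y \<in> cell B Q" "y' \<in> cell B Q" "y + y' \<in> W" for y y'
        using that B by (simp add: cell_def)
      show "\<exists>s\<in>cell S (P = Q). x + y + s \<in> W" if xy: "x \<in> cell A P" "y \<in> cell B Q" for x y
      proof -
        obtain s where s: "s \<in> S" "x + y + s \<in> W" using S[of x y] xy by (auto simp: cell_def)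
        \<comment> \<open>A representative lies on the same side of \<open>M\<close> as the sum it
          represents.\<close>
        then have "x + y + s \<in> M" using WM by blast
        then have "s \<in> cell S (P = Q)" using M xy s(1) by (simp add: cell_def)
        then show ?thesis using s(2) by blast
      qed
    qed (rule PQ)
    have "2 ^ k < card (cell A True) + card (cell B True)
      \<or> 2 ^ k < card (cell A False) + card (cell B False)"
      using big split[OF finA] split[OF finB] by auto
    then have "2 ^ k \<le> card (cell S True)" using step by fastforce
    moreover have "2 ^ k < card (cell A True) + card (cell B False)
      \<or> 2 ^ k < card (cell A False) + card (cell B True)"
      using big split[OF finA] split[OF finB] by auto
    then have "2 ^ k \<le> card (cell S False)" using step by fastforce
    ultimately show ?thesis using split[OF finS] by simp
  qed
qed

section \<open>The lower bound\<close>

lemma complete_digraph_graph: "complete_digraph n G \<Longrightarrow> graph G"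
  and complete_digraph_card: "complete_digraph n G \<Longrightarrow> card (verts G) = n"
  by (simp_all add: complete_digraph_def)

lemma complete_digraph_arcE:
  assumes "complete_digraph n G" "u \<in> verts G" "v \<in> verts G" "u \<noteq> v"
  obtains e where "e \<in> arcs G" "tail G e = u" "head G e = v"
proof -
  have "(u, v) \<in> arcs_ends G" using assms by (simp add: complete_digraph_def)
  then show ?thesis using that by (auto simp: arcs_ends_def arc_to_ends_def)
qed

lemma complete_digraph_arc_ends:
  assumes "complete_digraph n G" "e \<in> arcs G"
  shows "tail G e \<in> verts G" "head G e \<in> verts G" "tail G e \<noteq> head G e"
proof -
  have "(tail G e, head G e) \<in> arcs_ends G"
    using assms(2) by (auto simp: arcs_ends_def arc_to_ends_def)
  then show "tail G e \<in> verts G" "head G e \<in> verts G" "tail G e \<noteq> head G e"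
    using assms(1) by (simp_all add: complete_digraph_def)
qed

text \<open>With values in the field \<open>bit\<close>, pointwise addition makes these vectors a
  group of exponent 2.\<close>

definition parity_vec :: "'c list \<Rightarrow> 'c \<Rightarrow> bit" where
  "parity_vec xs = (\<lambda>x. of_nat (count_list xs x))"

lemma parity_vec_append: "parity_vec (xs @ ys) = parity_vec xs + parity_vec ys"
  by (simp add: parity_vec_def fun_eq_iff)

lemma of_nat_bit_eq_0_iff: "(of_nat n :: bit) = 0 \<longleftrightarrow> even n"
  by (induction n) auto

lemma parity_vec_eq_0_iff: "parity_vec xs = 0 \<longleftrightarrow> (\<forall>x. even (count_list xs x))"
  by (simp add: parity_vec_def fun_eq_iff of_nat_bit_eq_0_iff)

lemma bit_fun_double: "(x :: 'c \<Rightarrow> bit) + x = 0"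
  by (simp add: fun_eq_iff)

text \<open>\<open>Suc\<close> accounts for the sum 0 of a potential with itself.\<close>

lemma strong_parity_edge_coloring_card_ge:
  fixes c :: "'a set \<Rightarrow> 'c" and G :: "('a, 'b) pre_digraph"
  assumes G: "complete_digraph n G" and c: "strong_parity_edge_coloring G c"
    and k: "2 ^ k < 2 * n"
  shows "2 ^ k \<le> Suc (card (c ` edges G))"
proof -
  interpret graph G using G by (rule complete_digraph_graph)
  have "card (verts G) = n" using G by (rule complete_digraph_card)
  then have "verts G \<noteq> {}" using k by auto
  then obtain r where r: "r \<in> verts G" by blast
  define par where "par p = parity_vec (map (c \<circ> edge_of G) p)" for p
  \<comment> \<open>Parity of the walk with at most one edge from \<open>u\<close> to
    \<open>v\<close>; \<open>\<delta> r\<close> serves as the potential.\<close>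
  define \<delta> where "\<delta> u v = (if u = v then 0 else parity_vec [c {u, v}])" for u v
  have \<delta>_comm: "\<delta> u v = \<delta> v u" for u v by (simp add: \<delta>_def insert_commute)
  have par_append: "par (p @ q) = par p + par q" for p q
    by (simp add: par_def parity_vec_append)
  have walk: "\<exists>p. awalk u p v \<and> par p = \<delta> u v" if uv: "u \<in> verts G" "v \<in> verts G" for u v
  proof (cases "u = v")
    case True
    then show ?thesis
      using uv by (intro exI[of _ "[]"]) (simp add: awalk_Nil_iff par_def \<delta>_def parity_vec_eq_0_iff)
  next
    case False
    then obtain e where "e \<in> arcs G" "tail G e = u" "head G e = v"
      using complete_digraph_arcE[OF G uv] by blast
    then show ?thesis using False
      by (intro exI[of _ "[e]"]) (auto simp: awalk_simps par_def \<delta>_def edge_of_def)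
  qed
  have open_ne: "u = v" if "awalk u p v" "par p = 0" for u p v
    using c that unfolding strong_parity_edge_coloring_def parity_walk_def par_def parity_vec_eq_0_iff
    by blast
  define W where "W = {par p | p. awalk r p r}"
  have zero: "0 \<in> W" using walk[OF r r] by (auto simp: W_def \<delta>_def)
  have add: "x + y \<in> W" if "x \<in> W" "y \<in> W" for x y
    using that unfolding W_def by (auto simp flip: par_append intro: awalk_appendI)
  \<comment> \<open>Going from \<open>u\<close> to \<open>r\<close>, around the closed walk behind
    \<open>w\<close>, then on to \<open>v\<close> uses every color evenly.\<close>
  have inj: "u = v" if uv: "u \<in> verts G" "v \<in> verts G" and w: "\<delta> r u + \<delta> r v \<in> W" for u v
  proof -
    obtain p where p: "awalk r p r" "par p = \<delta> r u + \<delta> r v" using w by (auto simp: W_def)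
    obtain s where s: "awalk u s r" "par s = \<delta> u r" using walk uv r by blast
    obtain t where t: "awalk r t v" "par t = \<delta> r v" using walk uv r by blast
    have "par (s @ p @ t) = (\<delta> r u + \<delta> r u) + (\<delta> r v + \<delta> r v)"
      using p s t by (simp add: par_append \<delta>_comm[of u r] algebra_simps)
    then have "par (s @ p @ t) = 0" by (simp only: bit_fun_double add_0)
    moreover have "awalk u (s @ p @ t) v" using p s t by (blast intro: awalk_appendI)
    ultimately show ?thesis using open_ne by blast
  qed
  let ?A = "\<delta> r ` verts G" and ?S = "insert 0 ((\<lambda>x. parity_vec [x]) ` c ` edges G)"
  have "\<delta> r u = \<delta> r v \<Longrightarrow> \<delta> r u + \<delta> r v \<in> W" for u v by (simp only: bit_fun_double zero)
  then have "inj_on (\<delta> r) (verts G)" using inj by (auto intro!: inj_onI)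
  then have cardA: "card ?A = n" using \<open>card (verts G) = n\<close> by (simp add: card_image)
  \<comment> \<open>The closed walk through \<open>r\<close>, \<open>u\<close>, \<open>v\<close> and
    back shows that \<open>a + b\<close> is congruent to \<open>\<delta> u v\<close>.\<close>
  have cover: "\<exists>s\<in>?S. a + b + s \<in> W" if ab: "a \<in> ?A" "b \<in> ?A" for a b
  proof -
    obtain u v where uv: "u \<in> verts G" "v \<in> verts G" "a = \<delta> r u" "b = \<delta> r v" using ab by blast
    have "\<delta> u v \<in> ?S"
    proof (cases "u = v")
      case False
      then obtain e where "e \<in> arcs G" "tail G e = u" "head G e = v"
        using complete_digraph_arcE[OF G uv(1,2)] by blast
      then have "{u, v} \<in> edges G" by (auto simp: edges_def edge_of_def)
      then show ?thesis using False by (simp add: \<delta>_def)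
    qed (simp add: \<delta>_def)
    moreover have "a + b + \<delta> u v \<in> W"
    proof -
      obtain p where p: "awalk r p u" "par p = \<delta> r u" using walk uv r by blast
      obtain q where q: "awalk u q v" "par q = \<delta> u v" using walk uv r by blast
      obtain s where s: "awalk v s r" "par s = \<delta> v r" using walk uv r by blast
      have "awalk r (p @ q @ s) r" using p q s by (blast intro: awalk_appendI)
      moreover have "par (p @ q @ s) = a + b + \<delta> u v"
        using p q s uv by (simp add: par_append \<delta>_comm[of v r] algebra_simps)
      ultimately show ?thesis unfolding W_def by (metis (mono_tags, lifting) mem_Collect_eq)
    qed
    ultimately show ?thesis by blast
  qed
  have fin: "finite (c ` edges G)" by (simp add: edges_def)
  have ne: "?A \<noteq> {}" using r by blast
  have incong: "a = a'" if "a \<in> ?A" "a' \<in> ?A" "a + a' \<in> W" for a a'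
    using that inj by (metis imageE)
  have "2 ^ k \<le> card ?S"
  proof (rule card_sumset_mod_ge[OF bit_fun_double zero add _ ne incong _ ne incong])
    show "2 ^ k < card ?A + card ?A" using k cardA by simp
  qed (use fin cover in simp_all)
  also have "\<dots> \<le> Suc (card ((\<lambda>x. parity_vec [x]) ` c ` edges G))"
    by (rule card_insert_le_m1) simp_all
  also have "\<dots> \<le> Suc (card (c ` edges G))" using fin by (simp add: card_image_le)
  finally show ?thesis .
qed

section \<open>The upper bound\<close>

text \<open>Group the entries by value. Taking \<open>P\<close> to test one bit turns even color
  counts into an even number of flips of that bit.\<close>

lemma even_length_filter_if_even_counts:
  assumes "\<And>x. even (count_list xs x)"
  shows "even (length (filter P xs))"
proof -
  have "length (filter P xs) = sum_list (map (\<lambda>x. of_bool (P x)) xs)"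
    by (induction xs) auto
  also have "\<dots> = (\<Sum>x\<in>set xs. count_list xs x * of_bool (P x))"
    by (rule sum_list_map_eq_sum_count)
  finally show ?thesis using assms by (auto intro!: dvd_sum)
qed

text \<open>\<open>SOME\<close> orders the unordered pair; symmetry of XOR makes the choice
  harmless.\<close>

definition xor_coloring :: "('a \<Rightarrow> nat) \<Rightarrow> 'a set \<Rightarrow> nat" where
  "xor_coloring f E = (SOME m. \<exists>u v. E = {u, v} \<and> m = Bit_Operations.xor (f u) (f v))"

lemma xor_coloring_doubleton: "xor_coloring f {u, v} = Bit_Operations.xor (f u) (f v)"
  unfolding xor_coloring_def
  by (rule someI2[of _ "Bit_Operations.xor (f u) (f v)"])
    (auto simp: doubleton_eq_iff xor.commute)

text \<open>XOR telescopes: an edge flips bit \<open>i\<close> of the label exactly when its color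
  has that bit.\<close>

lemma (in pre_digraph) xor_coloring_awalk:
  assumes "cas u p v"
  shows "odd (length (filter (\<lambda>x. bit x i) (map (xor_coloring f \<circ> edge_of G) p)))
    \<longleftrightarrow> bit (f u) i \<noteq> bit (f v) i"
  using assms
  by (induction p arbitrary: u) (auto simp: edge_of_def xor_coloring_doubleton bit_xor_iff)

lemma xor_coloring_strong_parity:
  fixes G :: "('a, 'b) pre_digraph"
  assumes "graph G" and inj: "inj_on f (verts G)"
  shows "strong_parity_edge_coloring G (xor_coloring f)"
  unfolding strong_parity_edge_coloring_def
proof (intro allI impI)
  fix u p v assume p: "parity_walk G (xor_coloring f) u p v"
  interpret graph G by fact
  have w: "awalk u p v" using p by (simp add: parity_walk_def)
  then have "cas u p v" by auto
  then have "bit (f u) i = bit (f v) i" for i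
    using xor_coloring_awalk[of u p v i f] p even_length_filter_if_even_counts
    unfolding parity_walk_def by blast
  then have "f u = f v" by (simp add: bit_eq_iff)
  then show "u = v" using w inj by (auto dest: inj_onD)
qed

lemma ex_strong_parity_edge_coloring:
  fixes G :: "('a, 'b) pre_digraph"
  assumes G: "complete_digraph n G" and k: "n \<le> 2 ^ k"
  obtains c :: "'a set \<Rightarrow> nat"
  where "strong_parity_edge_coloring G c" "card (c ` edges G) \<le> 2 ^ k - 1"
proof -
  interpret graph G using G by (rule complete_digraph_graph)
  have "card (verts G) \<le> card {..<(2::nat) ^ k}" using complete_digraph_card[OF G] k by simp
  then obtain f where f: "f ` verts G \<subseteq> {..<(2::nat) ^ k}" "inj_on f (verts G)"
    using card_le_inj[of "verts G" "{..<(2::nat) ^ k}"] by auto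
  \<comment> \<open>Distinct labels never have XOR 0, which saves one color.\<close>
  have "xor_coloring f ` edges G \<subseteq> {1..<2 ^ k}"
  proof -
    have "xor_coloring f (edge_of G e) \<in> {1..<2 ^ k}" if e: "e \<in> arcs G" for e
    proof -
      let ?x = "f (tail G e)" and ?y = "f (head G e)"
      note ends = complete_digraph_arc_ends[OF G e]
      have "Bit_Operations.xor ?x ?y < 2 ^ k"
        \<comment> \<open>Below \<open>2 ^ k\<close> means fixed by \<open>take_bit k\<close>, which
          commutes with XOR.\<close>
        using f(1) ends by (simp add: image_subset_iff flip: take_bit_nat_eq_self_iff)
      moreover have "?x \<noteq> ?y" using f(2) ends by (auto dest: inj_onD)
      then have "Bit_Operations.xor ?x ?y \<noteq> 0"
        by (auto simp: bit_eq_iff bit_xor_iff)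
      ultimately show ?thesis by (simp add: edge_of_def xor_coloring_doubleton)
    qed
    then show ?thesis by (auto simp: edges_def)
  qed
  then have "card (xor_coloring f ` edges G) \<le> 2 ^ k - 1"
    using card_mono[of "{1..<(2::nat) ^ k}"] by fastforce
  then show ?thesis
    using that xor_coloring_strong_parity[OF graph_axioms f(2)] by blast
qed

theorem theorem3p12:
  fixes G :: "('a, 'b) pre_digraph" and n :: nat
  assumes "n \<ge> 1" and "complete_digraph n G"
  shows "p_hat G = 2 ^ nat \<lceil>log 2 (real n)\<rceil> - 1"
proof -
  define k where "k = nat \<lceil>log 2 (real n)\<rceil>"
  \<comment> \<open>Nonnegativity ensures that \<open>nat\<close> truncates nothing.\<close>
  have "log 2 (real n) \<ge> 0" using assms(1) by simp
  then have k: "real k \<ge> log 2 (real n)" "real k < log 2 (real n) + 1"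
    unfolding k_def by linarith+
  have "real n = 2 powr log 2 (real n)" using assms(1) by simp
  also have "\<dots> \<le> 2 powr real k" using k by (simp del: powr_log_cancel)
  finally have "real n \<le> real (2 ^ k)" by (simp add: powr_realpow)
  then have upper: "n \<le> 2 ^ k" by (simp only: of_nat_le_iff)
  have "real (2 ^ k) = 2 powr real k" by (simp add: powr_realpow)
  also have "\<dots> < 2 powr (log 2 (real n) + 1)" using k by simp
  also have "\<dots> = real (2 * n)" using assms(1) by (simp add: powr_add)
  finally have lower: "2 ^ k < 2 * n" by (simp only: of_nat_less_iff)
  obtain c :: "'a set \<Rightarrow> nat" where c: "strong_parity_edge_coloring G c"
    "card (c ` edges G) \<le> 2 ^ k - 1"
    using ex_strong_parity_edge_coloring[OF assms(2) upper] .
  have ge: "2 ^ k - 1 \<le> card (c' ` edges G)"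
    if "strong_parity_edge_coloring G c'" for c' :: "'a set \<Rightarrow> nat"
    using strong_parity_edge_coloring_card_ge[OF assms(2) that lower] by simp
  have "p_hat G = 2 ^ k - 1"
    unfolding p_hat_def
  proof (rule Least_equality)
    show "\<exists>c :: 'a set \<Rightarrow> nat. strong_parity_edge_coloring G c \<and> card (c ` edges G) = 2 ^ k - 1"
      using c ge[OF c(1)] by (intro exI[of _ c]) simp
  qed (use ge in blast)
  then show ?thesis by (simp only: k_def)
qed

end
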